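(* Let $\mathcal{X},\mathcal{Y}$ be finite alphabets. For any conditional distribution $P_{Y|X}$ from $\mathcal{X}$ to $\mathcal{Y}$, $$\mathcal{L}^{dp}(X\to Y)=L^{dp}(X\to Y).$$
   Context: $\log$ is the natural logarithm. Local differential privacy of $P_{Y|X}$ is $$L^{dp}(X\to Y)=\max_{y\in\mathcal{Y},\ x,x'\in\mathcal{X}}\log\frac{P_{Y|X}(y|x)}{P_{Y|X}(y|x')},$$ with $a/0=+\infty$ for $a>0$, and triples giving $0/0$ disregarded. The quantity $\mathcal{L}^{dp}$ is $$\mathcal{L}^{dp}(X\to Y)=\sup_{P_X}\ \sup_{U:\,U-X-Y}\log\frac{\max_{y\in\mathrm{supp}(Y)}\max_{u\in\mathcal{U}}P_{U|Y}(u|y)}{\max_{u\in\mathcal{U}}P_U(u)},$$ where $P_X$ ranges over all probability distributions on $\mathcal{X}$ (the joint law being $P_XP_{Y|X}$), $U-X-Y$ denotes a Markov chain, the alphabet $\mathcal{U}$ of $U$ is finite but of arbitrary size, and $\mathrm{supp}(Y)=\{y:P_Y(y)>0\}$. *)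

theory Defs
  imports "HOL-Probability.Probability"
begin

definition eln :: "ennreal \<Rightarrow> ereal" where
  "eln r = (if r = 0 then -\<infinity> else if r = \<top> then \<infinity> else ereal (ln (enn2real r)))"

(* Division in ennreal gives a / 0 = \<top> for a > 0. Each y in the support of some W x contributes
   the triple (y, x, x), so the maximum is over a nonempty finite set. *)
definition local_dp :: "('x::finite \<Rightarrow> 'y::finite pmf) \<Rightarrow> ereal" where
  "local_dp W =
     (MAX (y, x, x') \<in> {(y, x, x'). \<not> (pmf (W x) y = 0 \<and> pmf (W x') y = 0)}.
        eln (ennreal (pmf (W x) y) / ennreal (pmf (W x') y)))"

definition joint_law :: "'x pmf \<Rightarrow> ('x \<Rightarrow> 'y pmf) \<Rightarrow> ('x \<times> 'y) pmf" where
  "joint_law p W = bind_pmf p (\<lambda>x. map_pmf (\<lambda>y. (x, y)) (W x))"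

(* J is the joint law of a triple (U, X, Y). *)
definition markov_chain :: "('u \<times> 'x \<times> 'y) pmf \<Rightarrow> bool" where
  "markov_chain J \<longleftrightarrow>
     (\<forall>u x y. \<P>(\<omega> in measure_pmf J. fst (snd \<omega>) = x) > 0 \<longrightarrow>
        \<P>(\<omega> in measure_pmf J. fst \<omega> = u \<and> snd (snd \<omega>) = y \<bar> fst (snd \<omega>) = x) =
        \<P>(\<omega> in measure_pmf J. fst \<omega> = u \<bar> fst (snd \<omega>) = x) *
        \<P>(\<omega> in measure_pmf J. snd (snd \<omega>) = y \<bar> fst (snd \<omega>) = x))"

(* The argument A is the alphabet of U, which may contain letters of probability zero.
   For A finite and containing the support of U, both maxima are positive, so the real ln
   is applied to a positive number. *)
definition leakage :: "'u set \<Rightarrow> ('u \<times> 'x \<times> 'y) pmf \<Rightarrow> ereal" where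
  "leakage A J = ereal (ln (
     (MAX y \<in> set_pmf (map_pmf (\<lambda>(u, x, y). y) J). MAX u \<in> A.
        \<P>(\<omega> in measure_pmf J. fst \<omega> = u \<bar> snd (snd \<omega>) = y)) /
     (MAX u \<in> A. pmf (map_pmf fst J) u)))"

(* Finite alphabets of arbitrary size are represented, up to relabelling, by finite sets of
   natural numbers. *)
definition admissible ::
    "'x pmf \<Rightarrow> ('x \<Rightarrow> 'y pmf) \<Rightarrow> (nat set \<times> (nat \<times> 'x \<times> 'y) pmf) set" where
  "admissible p W =
     {(A, J). finite A \<and> set_pmf (map_pmf fst J) \<subseteq> A \<and>
        map_pmf snd J = joint_law p W \<and> markov_chain J}"

definition sup_leakage :: "('x::finite \<Rightarrow> 'y::finite pmf) \<Rightarrow> ereal" where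
  "sup_leakage W = (SUP p. SUP (A, J) \<in> admissible p W. leakage A J)"

end

theory Submission
  imports Defs
begin

text \<open>If every entry of the column \<open>W(y|\<cdot>)\<close> lies in \<open>[k, m]\<close>, the Markov property gives
  \<open>P(u, y) \<le> m P(u)\<close> and \<open>P(y) \<ge> k\<close>, so observing \<open>y\<close> inflates the probability of any
  \<open>u\<close> by a factor of at most \<open>m / k\<close>. Conversely, for given \<open>y\<close>, \<open>x\<close> and \<open>x'\<close> let
  \<open>U\<close> be uniform on \<open>n + 1\<close> letters, and feed \<open>x\<close> to the channel if \<open>U = 0\<close> and \<open>x'\<close>
  otherwise. The letter 0 has the maximal prior, and \<open>y\<close> inflates it by the factor
  \<open>(n + 1) W(y|x) / (W(y|x) + n W(y|x'))\<close>, which tends to \<open>W(y|x) / W(y|x')\<close>.\<close>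

section \<open>Probabilities of events under mixtures and joint laws\<close>

text \<open>Membership in \<open>S\<close> is a Boolean random variable, so the measure of
  \<open>S\<close> is a point mass of its law and \<open>pmf_bind\<close> applies.\<close>

lemma measure_bind_pmf_eq_integral:
  "measure (measure_pmf (bind_pmf p f)) S = (\<integral>x. measure (measure_pmf (f x)) S \<partial>measure_pmf p)"
proof -
  have *: "measure (measure_pmf q) S = pmf (map_pmf (\<lambda>\<omega>. \<omega> \<in> S) q) True" for q
    by (simp add: pmf_map vimage_def)
  show ?thesis
    unfolding * map_bind_pmf pmf_bind ..
qed

lemma measure_pmf_eq_sum_finite_class:
  fixes g :: "'a \<Rightarrow> 'b::finite"
  shows "measure (measure_pmf p) {\<omega>. P \<omega>} = (\<Sum>b\<in>UNIV. measure (measure_pmf p) {\<omega>. P \<omega> \<and> g \<omega> = b})"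
proof -
  have "{\<omega>. P \<omega>} = (\<Union>b\<in>UNIV. {\<omega>. P \<omega> \<and> g \<omega> = b})"
    by auto
  then show ?thesis
    by (simp only:) (intro measure_pmf.finite_measure_finite_Union,
        auto simp: disjoint_family_on_def)
qed

lemma pmf_joint_law:
  fixes p :: "'x::finite pmf"
  shows "pmf (joint_law p W) (x, y) = pmf p x * pmf (W x) y"
proof -
  have "measure (measure_pmf (W x')) ((\<lambda>y. (x', y)) -` {(x, y)}) = (if x' = x then pmf (W x) y else 0)" for x'
    by (auto simp: vimage_def measure_pmf_single)
  then have "pmf (joint_law p W) (x, y) = (\<Sum>x'\<in>UNIV. pmf p x' * (if x' = x then pmf (W x) y else 0))"
    unfolding joint_law_def pmf_bind pmf_map
    by (subst integral_measure_pmf[of UNIV]) (simp_all)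
  then show ?thesis
    by (simp add: if_distrib cong: if_cong)
qed

lemma cond_prob_measure_pmf:
  "\<P>(\<omega> in measure_pmf J. P \<omega> \<bar> Q \<omega>) =
     measure (measure_pmf J) {\<omega>. P \<omega> \<and> Q \<omega>} / measure (measure_pmf J) {\<omega>. Q \<omega>}"
  by (simp add: cond_prob_def)

subsection \<open>Leakage is at most local differential privacy\<close>

context
  fixes p :: "'x::finite pmf" and W :: "'x \<Rightarrow> 'y pmf" and J :: "('u \<times> 'x \<times> 'y) pmf"
  assumes marginal: "map_pmf snd J = joint_law p W" and markov: "markov_chain J"
begin

lemma measure_input_output:
  "measure (measure_pmf J) {\<omega>. snd (snd \<omega>) = y \<and> fst (snd \<omega>) = x} = pmf p x * pmf (W x) y"
proof -
  have "measure (measure_pmf J) {\<omega>. snd (snd \<omega>) = y \<and> fst (snd \<omega>) = x} = pmf (map_pmf snd J) (x, y)"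
    by (auto simp: pmf_map intro!: arg_cong[where f = "measure _"])
  then show ?thesis
    by (simp add: marginal pmf_joint_law)
qed

lemma measure_input:
  "measure (measure_pmf J) {\<omega>. fst (snd \<omega>) = x} = pmf p x"
proof -
  have "measure (measure_pmf J) {\<omega>. fst (snd \<omega>) = x} = pmf (map_pmf fst (map_pmf snd J)) x"
    by (auto simp: pmf_map map_pmf_comp intro!: arg_cong[where f = "measure _"])
  also have "\<dots> = pmf p x"
    unfolding marginal joint_law_def by (simp add: map_bind_pmf map_pmf_comp bind_return_pmf')
  finally show ?thesis .
qed

text \<open>This is the Markov property cleared of denominators. In product form it also covers
  inputs of probability zero, where both sides vanish, and so it can be summed over all
  inputs.\<close>

lemma measure_secret_output_input:
  "measure (measure_pmf J) {\<omega>. (fst \<omega> = u \<and> snd (snd \<omega>) = y) \<and> fst (snd \<omega>) = x} =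
     measure (measure_pmf J) {\<omega>. fst \<omega> = u \<and> fst (snd \<omega>) = x} * pmf (W x) y"
    (is "?l = ?r * _")
proof (cases "pmf p x = 0")
  case True
  have "?l \<le> pmf p x" "?r \<le> pmf p x"
    unfolding measure_input[symmetric] by (auto intro!: measure_pmf.finite_measure_mono)
  then have "?l = 0" "?r = 0"
    using True by (simp_all add: measure_le_0_iff)
  then show ?thesis
    by simp
next
  case False
  then have pos: "pmf p x > 0"
    by (simp add: pmf_pos)
  have "\<P>(\<omega> in measure_pmf J. fst \<omega> = u \<and> snd (snd \<omega>) = y \<bar> fst (snd \<omega>) = x) =
        \<P>(\<omega> in measure_pmf J. fst \<omega> = u \<bar> fst (snd \<omega>) = x) *
        \<P>(\<omega> in measure_pmf J. snd (snd \<omega>) = y \<bar> fst (snd \<omega>) = x)"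
    using markov pos unfolding markov_chain_def by (simp add: measure_input)
  then show ?thesis
    using pos by (simp add: cond_prob_measure_pmf measure_input measure_input_output)
qed

text \<open>Both probabilities are expanded over the input. The joint one weights the column entries
  by P(u, x), hence is at most \<open>m\<close> times P(u); that of \<open>y\<close> averages them
  under \<open>p\<close>, hence is at least \<open>k\<close>.\<close>

lemma cond_prob_secret_le:
  assumes lower: "\<And>x. k \<le> pmf (W x) y" and upper: "\<And>x. pmf (W x) y \<le> m" and "0 < k"
  shows "\<P>(\<omega> in measure_pmf J. fst \<omega> = u \<bar> snd (snd \<omega>) = y) \<le> m / k * pmf (map_pmf fst J) u"
proof -
  have "measure (measure_pmf J) {\<omega>. fst \<omega> = u \<and> snd (snd \<omega>) = y} =
      (\<Sum>x\<in>UNIV. measure (measure_pmf J) {\<omega>. fst \<omega> = u \<and> fst (snd \<omega>) = x} * pmf (W x) y)"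
    unfolding measure_secret_output_input[symmetric] by (rule measure_pmf_eq_sum_finite_class)
  also have "\<dots> \<le> (\<Sum>x\<in>UNIV. measure (measure_pmf J) {\<omega>. fst \<omega> = u \<and> fst (snd \<omega>) = x} * m)"
    by (intro sum_mono mult_left_mono upper) simp
  also have "\<dots> = m * measure (measure_pmf J) {\<omega>. fst \<omega> = u}"
    unfolding measure_pmf_eq_sum_finite_class[of J "\<lambda>\<omega>. fst \<omega> = u" "\<lambda>\<omega>. fst (snd \<omega>)"]
    by (simp add: sum_distrib_left mult.commute)
  also have "measure (measure_pmf J) {\<omega>. fst \<omega> = u} = pmf (map_pmf fst J) u"
    by (simp add: pmf_map vimage_def)
  finally have num: "measure (measure_pmf J) {\<omega>. fst \<omega> = u \<and> snd (snd \<omega>) = y} \<le> m * pmf (map_pmf fst J) u" .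
  have "k = (\<Sum>x\<in>UNIV. pmf p x * k)"
    by (simp add: sum_distrib_right[symmetric] sum_pmf_eq_1)
  also have "\<dots> \<le> (\<Sum>x\<in>UNIV. pmf p x * pmf (W x) y)"
    by (intro sum_mono mult_left_mono lower) simp
  also have "\<dots> = measure (measure_pmf J) {\<omega>. snd (snd \<omega>) = y}"
    unfolding measure_input_output[symmetric] by (rule measure_pmf_eq_sum_finite_class[symmetric])
  finally have den: "k \<le> measure (measure_pmf J) {\<omega>. snd (snd \<omega>) = y}" .
  \<comment> \<open>\<open>frac_le\<close> enlarges the numerator and shrinks the denominator at
    once, which asks for a nonnegative new numerator; by \<open>num\<close> it dominates a
    probability.\<close>
  have "0 \<le> m * pmf (map_pmf fst J) u"
    using num measure_nonneg order_trans by blast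
  then have "\<P>(\<omega> in measure_pmf J. fst \<omega> = u \<bar> snd (snd \<omega>) = y) \<le> (m * pmf (map_pmf fst J) u) / k"
    unfolding cond_prob_measure_pmf using num den \<open>0 < k\<close> by (intro frac_le) auto
  then show ?thesis
    by simp
qed

end

lemma local_dp_ge:
  fixes W :: "'x::finite \<Rightarrow> 'y::finite pmf"
  assumes "\<not> (pmf (W x) y = 0 \<and> pmf (W x') y = 0)"
  shows "eln (ennreal (pmf (W x) y) / ennreal (pmf (W x') y)) \<le> local_dp W"
proof -
  have "eln (ennreal (pmf (W x) y) / ennreal (pmf (W x') y)) \<in>
      (\<lambda>(y, x, x'). eln (ennreal (pmf (W x) y) / ennreal (pmf (W x') y))) `
        {(y, x, x'). \<not> (pmf (W x) y = 0 \<and> pmf (W x') y = 0)}"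
    by (rule image_eqI[of _ _ "(y, x, x')"]) (use assms in auto)
  then show ?thesis
    unfolding local_dp_def by (intro Max_ge) auto
qed

text \<open>Finite maxima are attained, so the leakage is a log ratio for one output
  \<open>y\<close> and one letter \<open>u\<close>. The extreme entries of column \<open>y\<close>,
  at \<open>x1\<close> and \<open>x0\<close>, bound that ratio, and \<open>(y, x1, x0)\<close> is
  one of the triples in \<open>local_dp\<close>.\<close>

lemma leakage_le_local_dp:
  fixes W :: "'x::finite \<Rightarrow> 'y::finite pmf"
  assumes "(A, J) \<in> admissible p W"
  shows "leakage A J \<le> local_dp W"
proof -
  have A: "finite A" "set_pmf (map_pmf fst J) \<subseteq> A"
    and J: "map_pmf snd J = joint_law p W" "markov_chain J"
    using assms by (auto simp: admissible_def)
  have "A \<noteq> {}"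
    using A(2) set_pmf_not_empty[of "map_pmf fst J"] by blast
  define S where "S = set_pmf (map_pmf (\<lambda>(u, x, y). y) J)"
  define c where "c = (\<lambda>y u. \<P>(\<omega> in measure_pmf J. fst \<omega> = u \<bar> snd (snd \<omega>) = y))"
  define b where "b = (MAX u \<in> A. pmf (map_pmf fst J) u)"
  have S: "finite S" "S \<noteq> {}"
    by (auto simp: S_def set_pmf_not_empty)
  have "(MAX y \<in> S. MAX u \<in> A. c y u) \<in> (\<lambda>y. MAX u \<in> A. c y u) ` S"
    using S by (intro Max_in) auto
  then obtain y where y: "y \<in> S" "(MAX y \<in> S. MAX u \<in> A. c y u) = (MAX u \<in> A. c y u)"
    by (elim imageE)
  have "(MAX u \<in> A. c y u) \<in> c y ` A"
    using A(1) \<open>A \<noteq> {}\<close> by (intro Max_in) auto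
  then obtain u where u: "u \<in> A" "(MAX u \<in> A. c y u) = c y u"
    by (elim imageE)
  have leak: "leakage A J = ereal (ln (c y u / b))"
    using y(2) u(2) by (simp add: leakage_def S_def b_def c_def)
  have bge: "pmf (map_pmf fst J) v \<le> b" if "v \<in> A" for v
    unfolding b_def using that A(1) by (intro Max_ge) auto
  \<comment> \<open>Some letter has positive probability, and it lies in \<open>A\<close> because
    \<open>A\<close> contains the support of the secret.\<close>
  have "b > 0"
  proof -
    obtain v where "v \<in> set_pmf (map_pmf fst J)"
      using set_pmf_not_empty[of "map_pmf fst J"] by blast
    then show ?thesis
      using bge[of v] A(2) pmf_positive[of v "map_pmf fst J"] by fastforce
  qed
  obtain x1 where x1: "\<And>x. pmf (W x) y \<le> pmf (W x1) y"
  proof -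
    have "(MAX x. pmf (W x) y) \<in> range (\<lambda>x. pmf (W x) y)"
      by (intro Max_in) auto
    then obtain x1 where "(MAX x. pmf (W x) y) = pmf (W x1) y"
      by (elim imageE)
    moreover have "pmf (W x) y \<le> pmf (W x1) y" for x
      unfolding calculation[symmetric] by (intro Max_ge) auto
    ultimately show ?thesis
      using that by blast
  qed
  obtain x0 where x0: "\<And>x. pmf (W x0) y \<le> pmf (W x) y"
  proof -
    have "(MIN x. pmf (W x) y) \<in> range (\<lambda>x. pmf (W x) y)"
      by (intro Min_in) auto
    then obtain x0 where "(MIN x. pmf (W x) y) = pmf (W x0) y"
      by (elim imageE)
    moreover have "pmf (W x0) y \<le> pmf (W x) y" for x
      unfolding calculation[symmetric] by (intro Min_le) auto
    ultimately show ?thesis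
      using that by blast
  qed
  \<comment> \<open>Since \<open>y\<close> occurs with positive probability, some input can produce
    it; hence the triple is not of the disregarded form 0/0.\<close>
  have pos1: "pmf (W x1) y > 0"
  proof -
    obtain \<omega> where \<omega>: "\<omega> \<in> set_pmf J" "y = snd (snd \<omega>)"
      using y(1) by (auto simp: S_def)
    then have "snd \<omega> \<in> set_pmf (joint_law p W)"
      unfolding J(1)[symmetric] by auto
    then have "y \<in> set_pmf (W (fst (snd \<omega>)))"
      using \<omega>(2) by (auto simp: joint_law_def)
    then show ?thesis
      using pmf_positive x1 by (metis less_le_trans)
  qed
  have dp: "eln (ennreal (pmf (W x1) y) / ennreal (pmf (W x0) y)) \<le> local_dp W"
    using pos1 by (intro local_dp_ge) auto
  show ?thesis
  proof (cases "pmf (W x0) y = 0")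
    \<comment> \<open>A zero in the column makes the ratio infinite, so \<open>local_dp W\<close> is
      infinite and the bound is trivial.\<close>
    case True
    then show ?thesis
      using dp pos1 by (simp add: eln_def)
  next
    case False
    then have pos0: "pmf (W x0) y > 0"
      by (simp add: pmf_pos)
    define r where "r = pmf (W x1) y / pmf (W x0) y"
    have "r \<ge> 1"
      using x1 pos0 by (simp add: r_def)
    have "c y u \<le> r * pmf (map_pmf fst J) u"
      unfolding c_def r_def by (rule cond_prob_secret_le[OF J x0 x1 pos0])
    also have "\<dots> \<le> r * b"
      using \<open>r \<ge> 1\<close> bge[OF u(1)] by (intro mult_left_mono) auto
    finally have "c y u / b \<le> r"
      using \<open>b > 0\<close> by (simp add: field_simps)
    moreover have "c y u / b \<ge> 0"
      using \<open>b > 0\<close> by (simp add: c_def cond_prob_measure_pmf)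
    ultimately have "ln (c y u / b) \<le> ln r" \<comment> \<open>If \<open>c y u = 0\<close>, this uses \<open>ln 0 = 0\<close>.\<close>
      using \<open>r \<ge> 1\<close> by (cases "c y u / b = 0") (simp_all del: divide_eq_0_iff)
    moreover have "eln (ennreal (pmf (W x1) y) / ennreal (pmf (W x0) y)) = ereal (ln r)"
      using pos0 \<open>r \<ge> 1\<close> by (simp add: divide_ennreal eln_def r_def)
    ultimately show ?thesis
      using dp leak by (metis ereal_less_eq(3) order_trans)
  qed
qed

subsection \<open>Two-point priors attain local differential privacy\<close>

text \<open>The secret is drawn first and encoded deterministically by \<open>f\<close>. The output
  sees it only through the input, so the Markov property is built in.\<close>

definition triple_law :: "'u pmf \<Rightarrow> ('u \<Rightarrow> 'x) \<Rightarrow> ('x \<Rightarrow> 'y pmf) \<Rightarrow> ('u \<times> 'x \<times> 'y) pmf" where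
  "triple_law q f W = bind_pmf q (\<lambda>u. map_pmf (\<lambda>y. (u, f u, y)) (W (f u)))"

lemma measure_triple_law:
  "measure (measure_pmf (triple_law q f W)) {\<omega>. P \<omega>} =
     (\<integral>u. measure (measure_pmf (W (f u))) {y. P (u, f u, y)} \<partial>measure_pmf q)"
  unfolding triple_law_def measure_bind_pmf_eq_integral by (simp add: vimage_def)

lemma map_fst_triple_law: "map_pmf fst (triple_law q f W) = q"
  by (simp add: triple_law_def map_bind_pmf map_pmf_comp bind_return_pmf')

lemma map_snd_triple_law: "map_pmf snd (triple_law q f W) = joint_law (map_pmf f q) W"
  by (simp add: triple_law_def joint_law_def map_bind_pmf bind_map_pmf map_pmf_comp)

text \<open>\<open>P\<close> is left general so that one factorization serves twice: the event that
  the secret is \<open>u\<close> gives the joint conditional law, the trivial event gives the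
  channel itself.\<close>

lemma measure_triple_law_factor:
  "measure (measure_pmf (triple_law q f W)) {\<omega>. P (fst \<omega>) \<and> snd (snd \<omega>) = y \<and> fst (snd \<omega>) = x} =
   measure (measure_pmf (triple_law q f W)) {\<omega>. P (fst \<omega>) \<and> fst (snd \<omega>) = x} * pmf (W x) y"
proof -
  have "measure (measure_pmf (W (f u))) {y'. P u \<and> y' = y \<and> f u = x} =
      measure (measure_pmf (W (f u))) {y'. P u \<and> f u = x} * pmf (W x) y" for u
    by (auto simp: measure_pmf_single)
  then show ?thesis
    unfolding measure_triple_law by simp
qed

lemma markov_chain_triple_law: "markov_chain (triple_law q f W)"
  unfolding markov_chain_def
proof (intro allI impI)
  fix u x y
  let ?J = "triple_law q f W"
  assume "\<P>(\<omega> in measure_pmf ?J. fst (snd \<omega>) = x) > 0"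
  then show "\<P>(\<omega> in measure_pmf ?J. fst \<omega> = u \<and> snd (snd \<omega>) = y \<bar> fst (snd \<omega>) = x) =
        \<P>(\<omega> in measure_pmf ?J. fst \<omega> = u \<bar> fst (snd \<omega>) = x) *
        \<P>(\<omega> in measure_pmf ?J. snd (snd \<omega>) = y \<bar> fst (snd \<omega>) = x)"
    using measure_triple_law_factor[of q f W "\<lambda>u'. u' = u" y x]
      measure_triple_law_factor[of q f W "\<lambda>_. True" y x]
    by (simp add: cond_prob_measure_pmf)
qed

text \<open>The bound is explicit in \<open>n\<close> and allows a vanishing entry at
  \<open>x'\<close>, so that letting \<open>n\<close> grow yields finite and infinite ratios
  alike.\<close>

lemma sup_leakage_ge_ln:
  fixes W :: "'x::finite \<Rightarrow> 'y::finite pmf"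
  assumes pos: "pmf (W x) y > 0"
  shows "ereal (ln (pmf (W x) y * real (Suc n) / (pmf (W x) y + real n * pmf (W x') y))) \<le> sup_leakage W"
proof -
  define A where "A = {..<Suc n}"
  define q where "q = pmf_of_set A"
  define f where "f = (\<lambda>u::nat. if u = 0 then x else x')"
  define J where "J = triple_law q f W"
  define w w' where "w = pmf (W x) y" and "w' = pmf (W x') y"
  define S where "S = set_pmf (map_pmf (\<lambda>(u, x, y). y) J)"
  define c where "c = (\<lambda>y u. \<P>(\<omega> in measure_pmf J. fst \<omega> = u \<bar> snd (snd \<omega>) = y))"
  have A: "finite A" "A \<noteq> {}" "card A = Suc n" "0 \<in> A"
    by (auto simp: A_def)
  have set_q: "set_pmf q = A"
    using A by (simp add: q_def)
  \<comment> \<open>The supremum also runs over priors, so the input law may be the one induced by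
    \<open>f\<close>.\<close>
  have "(A, J) \<in> admissible (map_pmf f q) W"
    unfolding admissible_def J_def
    using A by (simp add: map_fst_triple_law map_snd_triple_law markov_chain_triple_law set_q del: set_map_pmf)
  then have "leakage A J \<le> sup_leakage W"
    unfolding sup_leakage_def by (intro SUP_upper2[of "map_pmf f q"] SUP_upper2[of "(A, J)"]) auto
  moreover have "ln (w * real (Suc n) / (w + real n * w')) \<le> ln ((MAX y \<in> S. MAX u \<in> A. c y u) / (MAX u \<in> A. pmf (map_pmf fst J) u))"
  proof -
    have "pmf (map_pmf fst J) u = 1 / real (Suc n)" if "u \<in> A" for u
      unfolding J_def map_fst_triple_law q_def using A that by simp
    then have "(\<lambda>u. pmf (map_pmf fst J) u) ` A = {1 / real (Suc n)}"
      using A(2) by (auto simp: image_iff)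
    then have den: "(MAX u \<in> A. pmf (map_pmf fst J) u) = 1 / real (Suc n)"
      by simp
    \<comment> \<open>This separates letter 0, encoded as \<open>x\<close>, from the
      \<open>n\<close> letters encoded as \<open>x'\<close>.\<close>
    have split: "(\<Sum>u\<in>A. g u) = g 0 + (\<Sum>u<n. g (Suc u))" for g :: "nat \<Rightarrow> real"
      unfolding A_def by (rule sum.lessThan_Suc_shift)
    have joint: "measure (measure_pmf J) {\<omega>. fst \<omega> = 0 \<and> snd (snd \<omega>) = y} = w / real (Suc n)"
      unfolding J_def measure_triple_law q_def using A
      by (simp add: integral_pmf_of_set split f_def w_def measure_pmf_single)
    have out: "measure (measure_pmf J) {\<omega>. snd (snd \<omega>) = y} = (w + real n * w') / real (Suc n)"
      unfolding J_def measure_triple_law q_def using A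
      by (simp add: integral_pmf_of_set split f_def w_def w'_def measure_pmf_single)
    have c0: "c y 0 = w / (w + real n * w')"
      by (simp add: c_def cond_prob_measure_pmf joint out del: of_nat_Suc)
    have "y \<in> S"
    proof -
      have "y \<in> set_pmf (W x)"
        using pos by (simp add: set_pmf_iff)
      then have "(0, x, y) \<in> set_pmf J"
        using set_q A(4) by (force simp: J_def triple_law_def f_def)
      then show ?thesis
        by (force simp: S_def)
    qed
    then have "(MAX u \<in> A. c y u) \<le> (MAX y \<in> S. MAX u \<in> A. c y u)"
      by (intro Max_ge) auto
    moreover have "c y 0 \<le> (MAX u \<in> A. c y u)"
      using A by (intro Max_ge) auto
    \<comment> \<open>The prior maximum is known exactly, so a single output and a single letter
      suffice to bound the quotient from below.\<close>
    ultimately have le: "w / (w + real n * w') \<le> (MAX y \<in> S. MAX u \<in> A. c y u)"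
      by (simp add: c0)
    have "w > 0" "w' \<ge> 0"
      using pos by (simp_all add: w_def w'_def)
    then have "w * real (Suc n) / (w + real n * w') > 0"
      by (intro divide_pos_pos mult_pos_pos add_pos_nonneg) auto
    moreover have "w * real (Suc n) / (w + real n * w') \<le> (MAX y \<in> S. MAX u \<in> A. c y u) / (1 / real (Suc n))"
      using mult_right_mono[OF le, of "real (Suc n)"] by (simp del: of_nat_Suc)
    ultimately show ?thesis
      unfolding den by (subst ln_le_cancel_iff) auto
  qed
  ultimately show ?thesis
    unfolding leakage_def S_def c_def w_def w'_def
    by (metis (no_types, lifting) ereal_less_eq(3) order_trans)
qed

lemma sup_leakage_ge_eln:
  fixes W :: "'x::finite \<Rightarrow> 'y::finite pmf"
  assumes "\<not> (pmf (W x) y = 0 \<and> pmf (W x') y = 0)"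
  shows "eln (ennreal (pmf (W x) y) / ennreal (pmf (W x') y)) \<le> sup_leakage W"
proof -
  define w w' where "w = pmf (W x) y" and "w' = pmf (W x') y"
  consider "w = 0" "w' > 0" | "w > 0" "w' = 0" | "w > 0" "w' > 0"
    using assms by (metis pmf_pos w'_def w_def)
  then show ?thesis
  proof cases
    case 1
    then show ?thesis
      by (simp add: w_def w'_def eln_def divide_ennreal)
  next
    case 2
    \<comment> \<open>For \<open>w' = 0\<close> the factor \<open>w\<close> cancels and the
      inflation is exactly \<open>Suc n\<close>, which is unbounded.\<close>
    have "ereal (ln (real (Suc n))) \<le> sup_leakage W" for n
      using sup_leakage_ge_ln[of W x y n x'] 2 by (simp add: w_def w'_def)
    moreover have "(\<lambda>n. ereal (ln (real (Suc n)))) \<longlonglongrightarrow> \<infinity>"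
    proof -
      have "filterlim (\<lambda>n. ln (real (Suc n))) at_top sequentially"
        by (rule filterlim_compose[OF ln_at_top])
          (rule filterlim_compose[OF filterlim_real_sequentially filterlim_Suc])
      then show ?thesis
        by (simp add: tendsto_PInfty_eq_at_top)
    qed
    ultimately have "\<infinity> \<le> sup_leakage W"
      by (intro LIMSEQ_le_const2) auto
    then show ?thesis
      by simp
  next
    case 3
    \<comment> \<open>Since w + n w' = (n + 1) w' + (w - w'), dividing by n + 1 leaves
      \<open>n\<close> only in a vanishing term.\<close>
    have lim: "(\<lambda>n. w / (w' + (w - w') * inverse (real (Suc n)))) \<longlonglongrightarrow> w / (w' + (w - w') * 0)"
      by (intro tendsto_intros LIMSEQ_inverse_real_of_nat) (use 3 in simp)
    have "w / (w' + (w - w') * inverse (real (Suc n))) = w * real (Suc n) / (w + real n * w')" for n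
    proof -
      have "w' + (w - w') * inverse (real (Suc n)) = (w + real n * w') / real (Suc n)"
        by (simp add: field_simps)
      then show ?thesis
        by simp
    qed
    then have "(\<lambda>n. w * real (Suc n) / (w + real n * w')) \<longlonglongrightarrow> w / w'"
      using lim by simp
    then have "(\<lambda>n. ereal (ln (w * real (Suc n) / (w + real n * w')))) \<longlonglongrightarrow> ereal (ln (w / w'))"
      using 3 by (intro tendsto_ereal tendsto_ln) auto
    then have "ereal (ln (w / w')) \<le> sup_leakage W"
      by (rule LIMSEQ_le_const2) (use sup_leakage_ge_ln[of W x y _ x'] 3 in \<open>auto simp: w_def w'_def\<close>)
    moreover have "eln (ennreal w / ennreal w') = ereal (ln (w / w'))"
      using 3 by (simp add: divide_ennreal eln_def)
    ultimately show ?thesis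
      by (simp add: w_def w'_def)
  qed
qed

theorem theorem14:
  fixes W :: "'x::finite \<Rightarrow> 'y::finite pmf"
  shows "sup_leakage W = local_dp W"
proof (rule antisym)
  show "sup_leakage W \<le> local_dp W"
    unfolding sup_leakage_def by (auto intro!: SUP_least leakage_le_local_dp)
  \<comment> \<open>\<open>Max_le_iff\<close> asks for a nonempty set of triples; an output possible
    under \<open>x\<close> supplies a diagonal one.\<close>
  obtain y and x :: 'x where "y \<in> set_pmf (W x)"
    using set_pmf_not_empty[of "W _"] by (metis ex_in_conv)
  then have "(y, x, x) \<in> {(y, x, x'). \<not> (pmf (W x) y = 0 \<and> pmf (W x') y = 0)}"
    by (simp add: set_pmf_iff)
  then show "local_dp W \<le> sup_leakage W"
    unfolding local_dp_def by (subst Max_le_iff) (auto intro: sup_leakage_ge_eln)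
qed

end
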